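(* Let $\mathcal X$ be an RD-space, let $\rho$ be an admissible function on $\mathcal X$, and let $K_\rho:\mathcal X\times\mathcal X\to[0,\infty)$ be a measurable kernel for which there is a positive constant $C_5$ such that, for all $x,y\in\mathcal X$: (K)$_1$ $K_\rho(x,y)=0$ if $d(x,y)>C_5\min\{\rho(x),\rho(y)\}$; (K)$_2$ $K_\rho(x,y)\le C_5\frac1{\mu(B(x,\rho(x)))+\mu(B(y,\rho(y)))}$; (K)$_3$ $K_\rho(x,y)=K_\rho(y,x)$; (K)$_4$ $\int_{\mathcal X}K_\rho(x,y)\,d\mu(x)=1$ for all $y$. Put $K_\rho(f)(x)=\int_{\mathcal X}K_\rho(x,y)f(y)\,d\mu(y)$. Then $$\mathrm{BLO}_\rho(\mathcal X)=\{f\in\mathrm{BLO}(\mathcal X):\ K_\rho(f)\in L^\infty(\mathcal X)\}.$$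
   Context: RD-space: $(\mathcal X,d)$ is a metric space with a regular Borel measure $\mu$ such that all balls $B(x,r)=\{y: d(x,y)<r\}$ have finite and positive measure; $\mu$ is doubling, i.e. there is $A_1\ge1$ with $\mu(B(x,2r))\le A_1\mu(B(x,r))$ for all $x\in\mathcal X$, $r>0$; and there are $0<\kappa\le n$, $A_2\in(0,1]$, $A_3\in[1,\infty)$ such that $A_2\lambda^\kappa\mu(B(x,r))\le\mu(B(x,\lambda r))\le A_3\lambda^n\mu(B(x,r))$ for all $x\in\mathcal X$, $0<r\le \mathrm{diam}(\mathcal X)/2$ and $1\le\lambda\le \mathrm{diam}(\mathcal X)/(2r)$. Balls are understood together with their center and radius. Admissible function: $\rho:\mathcal X\to(0,\infty)$ is admissible if there are positive constants $C_0,k_0$ such that $\frac1{\rho(x)}\le C_0\frac1{\rho(y)}\left(1+\frac{d(x,y)}{\rho(y)}\right)^{k_0}$ for all $x,y\in\mathcal X$. Functions here are real-valued; $L^1_{\rm loc}(\mathcal X)$ means integrable on every ball. Let $\mathcal D$ be the collection of balls $B(x,r)$ with $r\ge\rho(x)$. The spaces consist of the $f\in L^1_{\rm loc}(\mathcal X)$ for which the following are finite: $$\|f\|_{\mathrm{BLO}(\mathcal X)}=\sup_{B\subset\mathcal X}\frac1{\mu(B)}\int_B\left[f-\operatorname*{ess\,inf}_B f\right]d\mu,$$ $$\|f\|_{\mathrm{BLO}_\rho(\mathcal X)}=\sup_{B\notin\mathcal D}\frac1{\mu(B)}\int_B\left[f-\operatorname*{ess\,inf}_B f\right]d\mu+\sup_{B\in\mathcal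 D}\frac1{\mu(B)}\int_B|f|\,d\mu.$$ *)

theory Defs
  imports "HOL-Analysis.Analysis" "HOL-Probability.Essential_Supremum"
begin

text \<open>
  The metric space is the whole type, equipped with a measure on its Borel sets.
  Regularity is outer approximation of Borel sets by open sets.
\<close>

definition regular_borel_measure :: "'a::metric_space measure \<Rightarrow> bool" where
  "regular_borel_measure M \<longleftrightarrow>
     sets M = sets borel \<and>
     (\<forall>A\<in>sets M. emeasure M A = (INF U\<in>{U. open U \<and> A \<subseteq> U}. emeasure M U))"

text \<open>
  The diameter has to be extended-real valued: the library function \<^const>\<open>diameter\<close> is \<open>0\<close> on
  unbounded sets.
\<close>

definition ediam :: "'a::metric_space set \<Rightarrow> ereal" where
  "ediam S = (SUP x\<in>S. SUP y\<in>S. ereal (dist x y))"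

definition doubling_measure :: "'a::metric_space measure \<Rightarrow> bool" where
  "doubling_measure M \<longleftrightarrow>
     (\<exists>A1\<ge>1. \<forall>x. \<forall>r>0. measure M (ball x (2 * r)) \<le> A1 * measure M (ball x r))"

definition RD_space :: "'a::metric_space measure \<Rightarrow> bool" where
  "RD_space M \<longleftrightarrow>
     regular_borel_measure M \<and>
     (\<forall>x. \<forall>r>0. 0 < emeasure M (ball x r) \<and> emeasure M (ball x r) < \<infinity>) \<and>
     doubling_measure M \<and>
     (\<exists>\<kappa> n A2 A3 :: real.
        0 < \<kappa> \<and> \<kappa> \<le> n \<and> 0 < A2 \<and> A2 \<le> 1 \<and> 1 \<le> A3 \<and>
        (\<forall>x r s. 0 < r \<and> ereal r \<le> ediam (UNIV :: 'a set) / 2 \<and>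
                 1 \<le> s \<and> ereal s \<le> ediam (UNIV :: 'a set) / ereal (2 * r) \<longrightarrow>
           A2 * s powr \<kappa> * measure M (ball x r) \<le> measure M (ball x (s * r)) \<and>
           measure M (ball x (s * r)) \<le> A3 * s powr n * measure M (ball x r)))"

definition admissible :: "('a::metric_space \<Rightarrow> real) \<Rightarrow> bool" where
  "admissible \<rho> \<longleftrightarrow>
     (\<forall>x. 0 < \<rho> x) \<and>
     (\<exists>C0>0. \<exists>k0>0. \<forall>x y.
        1 / \<rho> x \<le> C0 * (1 / \<rho> y) * (1 + dist x y / \<rho> y) powr k0)"

definition L1_loc :: "'a::metric_space measure \<Rightarrow> ('a \<Rightarrow> real) set" where
  "L1_loc M = {f \<in> borel_measurable M. \<forall>x. \<forall>r>0. set_integrable M (ball x r) f}"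

definition Linfty :: "'a measure \<Rightarrow> ('a \<Rightarrow> real) set" where
  "Linfty M = {g \<in> borel_measurable M. esssup M (\<lambda>x. ereal \<bar>g x\<bar>) < \<infinity>}"

definition essinf_on :: "'a measure \<Rightarrow> 'a set \<Rightarrow> ('a \<Rightarrow> real) \<Rightarrow> ereal" where
  "essinf_on M B f = Sup {c. AE y in M. y \<in> B \<longrightarrow> c \<le> ereal (f y)}"

text \<open>
  The integrand below is nonnegative almost everywhere on the ball, so the clipping at \<open>0\<close> by
  \<^const>\<open>e2ennreal\<close> is immaterial. If the essential infimum is \<open>-\<infinity>\<close>, the integrand and
  the mean value are \<open>\<infinity>\<close>.
\<close>

definition lower_osc :: "'a::metric_space measure \<Rightarrow> ('a \<Rightarrow> real) \<Rightarrow> 'a \<Rightarrow> real \<Rightarrow> ennreal" where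
  "lower_osc M f x r =
     (\<integral>\<^sup>+y\<in>ball x r. e2ennreal (ereal (f y) - essinf_on M (ball x r) f) \<partial>M)
       / emeasure M (ball x r)"

definition abs_mean :: "'a::metric_space measure \<Rightarrow> ('a \<Rightarrow> real) \<Rightarrow> 'a \<Rightarrow> real \<Rightarrow> ennreal" where
  "abs_mean M f x r = (\<integral>\<^sup>+y\<in>ball x r. ennreal \<bar>f y\<bar> \<partial>M) / emeasure M (ball x r)"

text \<open>
  A ball is a pair of a center and a positive radius, since membership in the family \<open>\<D>\<close> is not
  determined by the underlying point set.
\<close>

definition all_balls :: "('a \<times> real) set" where
  "all_balls = {(x, r). 0 < r}"

definition large_balls :: "('a \<Rightarrow> real) \<Rightarrow> ('a \<times> real) set" where
  "large_balls \<rho> = {(x, r) \<in> all_balls. \<rho> x \<le> r}"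

definition BLO_norm :: "'a::metric_space measure \<Rightarrow> ('a \<Rightarrow> real) \<Rightarrow> ennreal" where
  "BLO_norm M f = (SUP (x, r)\<in>all_balls. lower_osc M f x r)"

definition BLO_rho_norm ::
    "'a::metric_space measure \<Rightarrow> ('a \<Rightarrow> real) \<Rightarrow> ('a \<Rightarrow> real) \<Rightarrow> ennreal" where
  "BLO_rho_norm M \<rho> f =
     (SUP (x, r)\<in>all_balls - large_balls \<rho>. lower_osc M f x r) +
     (SUP (x, r)\<in>large_balls \<rho>. abs_mean M f x r)"

definition BLO :: "'a::metric_space measure \<Rightarrow> ('a \<Rightarrow> real) set" where
  "BLO M = {f \<in> L1_loc M. BLO_norm M f < \<infinity>}"

definition BLO_rho :: "'a::metric_space measure \<Rightarrow> ('a \<Rightarrow> real) \<Rightarrow> ('a \<Rightarrow> real) set" where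
  "BLO_rho M \<rho> = {f \<in> L1_loc M. BLO_rho_norm M \<rho> f < \<infinity>}"

definition kernel_op :: "'a measure \<Rightarrow> ('a \<Rightarrow> 'a \<Rightarrow> real) \<Rightarrow> ('a \<Rightarrow> real) \<Rightarrow> 'a \<Rightarrow> real" where
  "kernel_op M K f x = (\<integral>y. K x y * f y \<partial>M)"

end

theory Submission
  imports Defs
begin

text \<open>
  A bound on the lower oscillation over a ball ties the mean of \<open>f\<close> to its essential infimum there.
  A bound on the means of \<open>\<bar>f\<bar>\<close> over the balls with \<open>\<rho> x \<le> r\<close> is therefore, for \<open>f\<close> in BLO, a
  two-sided bound on the essential infima over these balls, and \<open>K\<^sub>\<rho>(f)\<close> detects it: since
  \<open>K\<^sub>\<rho>(x, \<cdot>)\<close> has integral \<open>1\<close>, lives on a ball \<open>B\<^sub>x\<close> about \<open>x\<close> with radius a fixed multiple of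
  \<open>\<rho> x\<close>, and is bounded by a multiple of \<open>1 / \<mu>(B\<^sub>x)\<close>, it follows
  that \<open>\<bar>K\<^sub>\<rho>(f)(x) - m\<bar>\<close> is at most a constant times the mean of \<open>\<bar>f - m\<bar>\<close> over \<open>B\<^sub>x\<close>, for every
  real \<open>m\<close> (\<open>kernel_op_bound\<close>).

  If \<open>f\<close> is in \<open>BLO\<^sub>\<rho>\<close>, the choice \<open>m = 0\<close> bounds \<open>K\<^sub>\<rho>(f)\<close>. For the membership in BLO only
  the balls with \<open>\<rho> x \<le> r\<close> are at stake, and there it suffices that \<open>f\<close> is essentially bounded
  below on the whole space. This is a local matter: on the ball of radius \<open>\<rho> z / 2\<close> about \<open>z\<close> the
  essential infimum is close to the mean of \<open>f\<close>, which by doubling is controlled by the mean of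
  \<open>\<bar>f\<bar>\<close> over the ball of radius \<open>\<rho> z\<close>.

  Conversely, let \<open>f\<close> be in BLO with \<open>K\<^sub>\<rho>(f)\<close> essentially bounded. The choice of \<open>m\<close> as the
  essential infimum over \<open>B\<^sub>x\<close> bounds these infima for almost every \<open>x\<close>, hence for a dense set of
  \<open>x\<close>. The balls \<open>B\<^sub>x\<close> of such points cover the space, so \<open>f\<close> is essentially bounded below.
  Given a ball with \<open>\<rho> z \<le> r\<close>, a fixed dilate of it contains some such \<open>B\<^sub>x\<close>, because \<open>\<rho>\<close> varies
  slowly; the infimum over the dilate is then bounded on both sides, and so is the mean of \<open>\<bar>f\<bar>\<close>
  over the dilate and, by doubling, over the ball.

  Both lower bounds pass from local to global almost-everywhere statements
  (\<open>AE_if_locally_AE\<close>). This needs a countable cover, and the space is separable because disjoint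
  balls of positive measure inside a set of finite measure are countably many.
\<close>

section \<open>Essential infima and integrals over a set\<close>

text \<open>
  The defining supremum ranges over uncountably many lower bounds; it is reached along a sequence of
  them, which leaves a single null set.
\<close>
lemma AE_essinf_on_le: "AE y in M. y \<in> B \<longrightarrow> essinf_on M B f \<le> ereal (f y)"
proof -
  let ?A = "{c. AE y in M. y \<in> B \<longrightarrow> c \<le> ereal (f y)}"
  have "- \<infinity> \<in> ?A" by simp
  then obtain g :: "nat \<Rightarrow> ereal" where g: "range g \<subseteq> ?A" "Sup ?A = (SUP i. g i)"
    using Sup_countable_SUP[of ?A] by blast
  have "AE y in M. \<forall>i. y \<in> B \<longrightarrow> g i \<le> ereal (f y)"
    unfolding AE_all_countable using g(1) by blast
  then show ?thesis
    unfolding essinf_on_def g(2) by eventually_elim (simp add: SUP_le_iff)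
qed

lemma le_essinf_onI: "AE y in M. y \<in> B \<longrightarrow> c \<le> ereal (f y) \<Longrightarrow> c \<le> essinf_on M B f"
  unfolding essinf_on_def by (rule Sup_upper) simp

lemma essinf_on_antimono:
  fixes M :: "'a measure"
  assumes "A \<subseteq> B" shows "essinf_on M B f \<le> essinf_on M A f"
  using AE_essinf_on_le[where M = M and B = B and f = f] assms by (intro le_essinf_onI) (auto elim!: eventually_mono)

lemma L1_locD:
  assumes "f \<in> L1_loc M"
  shows "f \<in> borel_measurable M" and "0 < r \<Longrightarrow> set_integrable M (ball x r) f"
  using assms by (auto simp: L1_loc_def)

lemma nn_set_integral_abs:
  fixes g :: "'a \<Rightarrow> real"
  assumes "set_integrable M A g"
  shows "(\<integral>\<^sup>+y\<in>A. ennreal \<bar>g y\<bar> \<partial>M) = ennreal (LINT y:A|M. \<bar>g y\<bar>)"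
proof -
  have "(\<integral>\<^sup>+y\<in>A. ennreal \<bar>g y\<bar> \<partial>M) = (\<integral>\<^sup>+y. ennreal (indicator A y *\<^sub>R \<bar>g y\<bar>) \<partial>M)"
    by (intro nn_integral_cong) (auto simp: indicator_def)
  also have "\<dots> = ennreal (LINT y:A|M. \<bar>g y\<bar>)"
    unfolding set_lebesgue_integral_def
    using set_integrable_abs[OF assms] by (intro nn_integral_eq_integral) (auto simp: set_integrable_def)
  finally show ?thesis .
qed

lemma set_integral_abs_nonneg: "0 \<le> (LINT y:A|M. \<bar>g y :: real\<bar>)"
  unfolding set_lebesgue_integral_def by (rule Bochner_Integration.integral_nonneg) (simp add: indicator_def)

lemma set_integral_abs_mono_set:
  fixes g :: "'a \<Rightarrow> real"
  assumes "set_integrable M B g" "A \<in> sets M" "A \<subseteq> B"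
  shows "(LINT y:A|M. \<bar>g y\<bar>) \<le> (LINT y:B|M. \<bar>g y\<bar>)"
  using set_integrable_abs[OF assms(1)] set_integrable_abs[OF set_integrable_subset[OF assms]] assms(3)
  unfolding set_lebesgue_integral_def set_integrable_def
  by (intro integral_mono) (auto simp: indicator_def)

section \<open>Doubling metric measure spaces\<close>
locale doubling_metric_measure =
  fixes M :: "'a::metric_space measure"
  assumes sets_M: "sets M = sets borel"
    and emeasure_ball_pos: "0 < r \<Longrightarrow> 0 < emeasure M (ball x r)"
    and emeasure_ball_finite: "0 < r \<Longrightarrow> emeasure M (ball x r) < \<infinity>"
    and doubling: "doubling_measure M"
begin

lemma space_M [simp]: "space M = UNIV"
  using sets_eq_imp_space_eq[OF sets_M] by simp

lemma ball_in_sets [measurable, simp]: "ball x r \<in> sets M"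
  by (simp add: sets_M)

lemma measure_ball_pos: "0 < r \<Longrightarrow> 0 < measure M (ball x r)"
  using emeasure_ball_pos[of r x] emeasure_ball_finite[of r x]
  by (simp add: measure_def enn2real_positive_iff)

lemma emeasure_ball: "0 < r \<Longrightarrow> emeasure M (ball x r) = ennreal (measure M (ball x r))"
  using emeasure_ball_finite[of r x] by (intro emeasure_eq_ennreal_measure) auto

lemma fmeasurable_ball: "0 < r \<Longrightarrow> ball x r \<in> fmeasurable M"
  using emeasure_ball_finite[of r x] by (simp add: fmeasurable_def)

lemma set_integrable_const_ball: "0 < r \<Longrightarrow> set_integrable M (ball x r) (\<lambda>_. c::real)"
  using emeasure_ball_finite[of r x] unfolding set_integrable_def by simp

lemma sigma_finite: "sigma_finite_measure M"
proof
  fix x0 :: 'a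
  have "\<exists>n. dist x0 x < real (Suc n)" for x
    using reals_Archimedean2[of "dist x0 x"] by (metis less_trans lessI of_nat_less_iff)
  then show "\<exists>A. countable A \<and> A \<subseteq> sets M \<and> \<Union> A = space M \<and> (\<forall>a\<in>A. emeasure M a \<noteq> \<infinity>)"
    using emeasure_ball_finite[of "real (Suc _)" x0]
    by (intro exI[of _ "range (\<lambda>n. ball x0 (real (Suc n)))"]) (auto simp: less_top)
qed

text \<open>Iterating the doubling inequality \<open>k\<close> times serves all dilation factors up to \<open>2 ^ k\<close>.\<close>
lemma doubling_const:
  obtains A where "1 \<le> A"
    and "\<And>x r. 0 < r \<Longrightarrow> measure M (ball x (R * r)) \<le> A * measure M (ball x r)"
proof -
  obtain A1 where A1: "1 \<le> A1"
    "\<And>x r. 0 < r \<Longrightarrow> measure M (ball x (2 * r)) \<le> A1 * measure M (ball x r)"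
    using doubling unfolding doubling_measure_def by blast
  have pow: "measure M (ball x (2 ^ k * r)) \<le> A1 ^ k * measure M (ball x r)" if "0 < r" for k x r
  proof (induction k)
    case (Suc k)
    have "measure M (ball x (2 ^ Suc k * r)) \<le> A1 * measure M (ball x (2 ^ k * r))"
      using A1(2)[of "2 ^ k * r" x] that by (simp add: mult.assoc)
    also have "\<dots> \<le> A1 * (A1 ^ k * measure M (ball x r))"
      using Suc A1(1) by (intro mult_left_mono) auto
    finally show ?case by (simp add: mult.assoc)
  qed simp
  obtain k where k: "R < 2 ^ k"
    using real_arch_pow[of 2 R] by auto
  show thesis
  proof
    show "1 \<le> A1 ^ k" using A1(1) by simp
    fix x and r :: real assume r: "0 < r"
    have "measure M (ball x (R * r)) \<le> measure M (ball x (2 ^ k * r))"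
      using k r by (intro measure_mono_fmeasurable fmeasurable_ball subset_ball mult_right_mono) auto
    also have "\<dots> \<le> A1 ^ k * measure M (ball x r)" by (rule pow[OF r])
    finally show "measure M (ball x (R * r)) \<le> A1 ^ k * measure M (ball x r)" .
  qed
qed

text \<open>
  The balls of radius \<open>e/2\<close> about the points of \<open>S\<close> are disjoint. Sorting the points by their
  distance from a base point and by a lower bound for the measure of their balls exhausts \<open>S\<close> by
  countably many sets, each finite because its balls fit into one ball of finite measure.
\<close>
lemma countable_separated:
  fixes S :: "'a set"
  assumes "0 < e" and sep: "\<And>s t. s \<in> S \<Longrightarrow> t \<in> S \<Longrightarrow> s \<noteq> t \<Longrightarrow> e \<le> dist s t"
  shows "countable S"
proof -
  fix x0 :: 'a
  define T where "T n = {s \<in> S. dist x0 s < real n \<and> 1 < real n * measure M (ball s (e/2))}" for n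
  have "finite (T n)" for n
  proof -
    define V where "V = measure M (ball x0 (real n + e))"
    have "card G \<le> nat \<lceil>real n * V\<rceil>" if G: "G \<subseteq> T n" "finite G" for G
    proof -
      have disj: "disjoint_family_on (\<lambda>s. ball s (e/2)) G"
      proof (unfold disjoint_family_on_def, intro ballI impI)
        fix s t assume st: "s \<in> G" "t \<in> G" "s \<noteq> t"
        then have "e \<le> dist s t" using sep G by (auto simp: T_def)
        then show "ball s (e/2) \<inter> ball t (e/2) = {}"
          using dist_triangle_half_l[of s _ e t] by (force simp: dist_commute)
      qed
      have "real (card G) \<le> (\<Sum>s\<in>G. real n * measure M (ball s (e/2)))"
        using G sum_mono[of G "\<lambda>_. 1" "\<lambda>s. real n * measure M (ball s (e/2))"]
        by (force simp: T_def)
      also have "\<dots> = real n * measure M (\<Union>s\<in>G. ball s (e/2))"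
        using emeasure_ball_finite[of "e/2"] assms(1) G disj
        by (subst measure_finite_Union) (auto simp: sum_distrib_left less_top)
      also have "measure M (\<Union>s\<in>G. ball s (e/2)) \<le> V"
        unfolding V_def
      proof (rule measure_mono_fmeasurable)
        show "(\<Union>s\<in>G. ball s (e/2)) \<subseteq> ball x0 (real n + e)"
        proof (clarsimp)
          fix s y assume "s \<in> G" "dist s y * 2 < e"
          then have "dist x0 s < real n" "dist s y < e"
            using G zero_le_dist[of s y] by (auto simp: T_def simp del: zero_le_dist)
          then show "dist x0 y < real n + e"
            using dist_triangle[of x0 y s] by linarith
        qed
        show "ball x0 (real n + e) \<in> fmeasurable M"
          using assms(1) by (intro fmeasurable_ball) (simp add: add_nonneg_pos)
        show "(\<Union>s\<in>G. ball s (e/2)) \<in> sets M"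
          unfolding sets_M by (intro borel_open open_UN) simp
      qed
      finally have "real (card G) \<le> real n * V" by (simp add: mult_left_mono)
      then show ?thesis by linarith
    qed
    then show ?thesis using finite_if_finite_subsets_card_bdd by blast
  qed
  moreover have "S \<subseteq> (\<Union>n. T n)"
  proof
    fix s assume s: "s \<in> S"
    have pos: "0 < measure M (ball s (e/2))" using assms(1) by (simp add: measure_ball_pos)
    obtain n where n: "max (dist x0 s) (1 / measure M (ball s (e/2))) < real n"
      using reals_Archimedean2 by blast
    then show "s \<in> (\<Union>n. T n)" using s pos by (auto simp: T_def field_simps)
  qed
  ultimately show ?thesis
    by (meson countable_UN countable_finite countable_subset countableI_type)
qed

text \<open>
  A maximal \<open>e\<close>-separated set is countable, and by maximality every point is within \<open>e\<close> of it. The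
  union of such sets for \<open>e = 1, 1/2, 1/3, \<dots>\<close> is dense.
\<close>
lemma separable:
  obtains D :: "'a set" where "countable D" "\<And>x e. 0 < e \<Longrightarrow> \<exists>d\<in>D. dist d x < e"
proof -
  have "\<exists>S :: 'a set. countable S \<and> (\<forall>x. \<exists>s\<in>S. dist s x < e)" if e: "0 < e" for e
  proof -
    define F where "F = {S :: 'a set. \<forall>s\<in>S. \<forall>t\<in>S. s \<noteq> t \<longrightarrow> e \<le> dist s t}"
    have "\<exists>S\<in>F. \<forall>X\<in>F. S \<subseteq> X \<longrightarrow> X = S"
    proof (rule subset_Zorn')
      fix C assume C: "subset.chain F C"
      then have "C \<subseteq> F" by (auto simp: subset.chain_def)
      have "e \<le> dist s t" if "X \<in> C" "Y \<in> C" "s \<in> X" "t \<in> Y" "s \<noteq> t" for X Y s t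
      proof -
        have "X \<subseteq> Y \<or> Y \<subseteq> X" using C that by (auto simp: subset.chain_def)
        then show ?thesis using that \<open>C \<subseteq> F\<close> unfolding F_def by blast
      qed
      then show "\<Union> C \<in> F" by (auto simp: F_def)
    qed
    then obtain S where S: "S \<in> F" "\<And>X. X \<in> F \<Longrightarrow> S \<subseteq> X \<Longrightarrow> X = S" by blast
    have "countable S" using S(1) by (intro countable_separated[OF e]) (auto simp: F_def)
    moreover have "\<exists>s\<in>S. dist s x < e" for x
    proof (rule ccontr)
      assume far: "\<not> (\<exists>s\<in>S. dist s x < e)"
      then have "insert x S \<in> F" using S(1) by (auto simp: F_def dist_commute not_less)
      then have "x \<in> S" using S(2) by blast
      then show False using far e by auto
    qed
    ultimately show ?thesis by blast
  qed
  then have "\<exists>S. \<forall>n. countable (S n :: 'a set) \<and> (\<forall>x. \<exists>s\<in>S n. dist s x < 1 / real (Suc n))"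
    by (intro choice) simp
  then obtain S where S: "\<And>n. countable (S n :: 'a set)"
    "\<And>n x. \<exists>s\<in>S n. dist s x < 1 / real (Suc n)" by blast
  show thesis
  proof
    show "countable (\<Union>n. S n)" using S(1) by simp
    fix x :: 'a and e :: real assume "0 < e"
    then obtain n where "1 / real (Suc n) < e" using nat_approx_posE by blast
    then show "\<exists>d\<in>\<Union>n. S n. dist d x < e" using S(2)[of n x] by (meson UNIV_I UN_I less_trans)
  qed
qed

text \<open>
  Among the balls with centers in a countable dense set and radii \<open>1 / (n + 1)\<close>, those on which the
  property holds almost everywhere already cover the space.
\<close>
lemma AE_if_locally_AE:
  assumes "\<And>z. \<exists>\<delta>>0. AE y in M. y \<in> ball z \<delta> \<longrightarrow> P y"
  shows "AE y in M. P y"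
proof -
  obtain D :: "'a set" where D: "countable D" "\<And>x e. 0 < e \<Longrightarrow> \<exists>d\<in>D. dist d x < e"
    using separable by blast
  define I where
    "I = {p \<in> D \<times> (UNIV :: nat set). AE y in M. y \<in> ball (fst p) (1 / real (Suc (snd p))) \<longrightarrow> P y}"
  have "countable I"
    unfolding I_def using D(1) by (intro countable_subset[OF Collect_restrict]) auto
  then have "AE y in M. \<forall>p\<in>I. y \<in> ball (fst p) (1 / real (Suc (snd p))) \<longrightarrow> P y"
    by (subst AE_ball_countable) (auto simp: I_def)
  then show ?thesis
  proof eventually_elim
    case (elim y)
    obtain \<delta> where \<delta>: "0 < \<delta>" "AE z in M. z \<in> ball y \<delta> \<longrightarrow> P z" using assms by blast
    obtain n where n: "1 / real (Suc n) < \<delta> / 2" using nat_approx_posE[of "\<delta>/2"] \<delta>(1) by auto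
    obtain d where d: "d \<in> D" "dist d y < 1 / real (Suc n)" using D(2)[of "1 / real (Suc n)" y] by auto
    have "ball d (1 / real (Suc n)) \<subseteq> ball y \<delta>"
    proof
      fix z assume "z \<in> ball d (1 / real (Suc n))"
      then show "z \<in> ball y \<delta>"
        using d(2) n dist_triangle[of y z d] by (simp add: dist_commute)
    qed
    then have "AE z in M. z \<in> ball d (1 / real (Suc n)) \<longrightarrow> P z"
      using \<delta>(2) by (auto elim!: eventually_mono)
    then have "(d, n) \<in> I" using d(1) by (simp add: I_def)
    then show "P y" using elim d(2) by force
  qed
qed

lemma AE_obtain_in_ball:
  assumes "AE y in M. P y" "0 < r"
  obtains y where "y \<in> ball x r" "P y"
proof (rule ccontr)
  assume "\<not> thesis"
  then have "AE y in M. y \<notin> ball x r" using that assms(1) by (auto elim!: eventually_mono)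
  then have "emeasure M (ball x r) = 0" by (subst (asm) AE_iff_measurable[OF ball_in_sets]) auto
  then show False using emeasure_ball_pos[OF assms(2), of x] by simp
qed

section \<open>Lower oscillation and means over balls\<close>
lemma abs_mean_eq:
  assumes f: "f \<in> L1_loc M" and r: "0 < r"
  shows "abs_mean M f x r = ennreal ((LINT y:ball x r|M. \<bar>f y\<bar>) / measure M (ball x r))"
proof -
  have "(\<integral>\<^sup>+y\<in>ball x r. ennreal \<bar>f y\<bar> \<partial>M) = ennreal (LINT y:ball x r|M. \<bar>f y\<bar>)"
    by (rule nn_set_integral_abs[OF L1_locD(2)[OF f r]])
  then show ?thesis
    using measure_ball_pos[OF r] unfolding abs_mean_def emeasure_ball[OF r]
    by (simp add: divide_ennreal set_integral_abs_nonneg)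
qed

lemma set_integral_abs_le:
  assumes "f \<in> L1_loc M" "0 < r" "0 \<le> N" "abs_mean M f x r \<le> ennreal N"
  shows "(LINT y:ball x r|M. \<bar>f y\<bar>) \<le> N * measure M (ball x r)"
  using assms measure_ball_pos[of r x] by (simp add: abs_mean_eq field_simps)

text \<open>
  Translates a bound on the extended-valued oscillation into real terms. An infimum \<open>\<infinity>\<close> would make
  the ball a null set, and an infimum \<open>- \<infinity>\<close> would make the oscillation infinite. The absolute value
  inside the integral changes nothing, as \<open>f \<ge> m\<close> almost everywhere on the ball; in this form the
  conclusion is the hypothesis of the kernel estimate.
\<close>
lemma essinf_of_lower_osc:
  assumes f: "f \<in> L1_loc M" and r: "0 < r" and N: "0 \<le> N"
    and osc: "lower_osc M f x r \<le> ennreal N"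
  obtains m where "essinf_on M (ball x r) f = ereal m"
    and "AE y in M. y \<in> ball x r \<longrightarrow> m \<le> f y"
    and "(LINT y:ball x r|M. \<bar>f y - m\<bar>) \<le> N * measure M (ball x r)"
proof -
  let ?B = "ball x r" and ?e = "essinf_on M (ball x r) f"
  define I where "I = (\<integral>\<^sup>+y\<in>?B. e2ennreal (ereal (f y) - ?e) \<partial>M)"
  have ne: "emeasure M ?B \<noteq> 0" "emeasure M ?B \<noteq> \<infinity>"
    using emeasure_ball_pos[OF r, of x] emeasure_ball_finite[OF r, of x] by auto
  have "I = I / emeasure M ?B * emeasure M ?B"
    unfolding ennreal_divide_times using ne by (simp add: ennreal_divide_self less_top[symmetric])
  also have "\<dots> \<le> ennreal N * emeasure M ?B"
    using osc unfolding lower_osc_def I_def by (intro mult_right_mono) auto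
  finally have I: "I \<le> ennreal N * emeasure M ?B" .
  then have I_fin: "I \<noteq> \<infinity>"
    using ne by (auto simp: top_unique ennreal_mult_eq_top_iff)
  have "?e \<noteq> \<infinity>"
  proof
    assume "?e = \<infinity>"
    then have "AE y in M. y \<notin> ?B" using AE_essinf_on_le[where M = M and B = ?B and f = f] by (auto elim!: eventually_mono)
    then show False using AE_obtain_in_ball[OF _ r, of "\<lambda>y. y \<notin> ?B" x] by blast
  qed
  moreover have "?e \<noteq> - \<infinity>"
  proof
    assume "?e = - \<infinity>"
    then have "I = (\<integral>\<^sup>+y\<in>?B. \<infinity> \<partial>M)" by (simp add: I_def)
    also have "\<dots> = \<infinity> * emeasure M ?B" by (rule nn_integral_cmult_indicator) simp
    also have "\<dots> = \<infinity>" using ne by (simp add: ennreal_top_mult)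
    finally show False using I_fin by simp
  qed
  ultimately obtain m where m: "?e = ereal m" by (cases ?e) auto
  have AEm: "AE y in M. y \<in> ?B \<longrightarrow> m \<le> f y" using AE_essinf_on_le[where M = M and B = ?B and f = f] by (simp add: m)
  have int: "set_integrable M ?B (\<lambda>y. f y - m)"
    by (intro set_integral_diff(1) L1_locD(2)[OF f r] set_integrable_const_ball r)
  have "ennreal (LINT y:?B|M. \<bar>f y - m\<bar>) = (\<integral>\<^sup>+y\<in>?B. ennreal \<bar>f y - m\<bar> \<partial>M)"
    by (rule nn_set_integral_abs[OF int, symmetric])
  also have "\<dots> = I"
    unfolding I_def m
    by (rule nn_integral_cong_AE, rule eventually_mono[OF AEm]) (auto simp: indicator_def)
  also note I
  finally have "ennreal (LINT y:?B|M. \<bar>f y - m\<bar>) \<le> ennreal (N * measure M ?B)"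
    using N by (simp add: emeasure_ball[OF r] ennreal_mult)
  then have "(LINT y:?B|M. \<bar>f y - m\<bar>) \<le> N * measure M ?B"
    using N by (subst (asm) ennreal_le_iff) auto
  with m AEm show thesis by (rule that)
qed

lemma lower_osc_le:
  assumes f: "f \<in> L1_loc M" and r: "0 < r" and C: "0 \<le> C" and "AE y in M. - C \<le> f y"
  shows "lower_osc M f x r \<le> abs_mean M f x r + ennreal C"
proof -
  let ?B = "ball x r"
  have [measurable]: "f \<in> borel_measurable M" using L1_locD(1)[OF f] .
  have e: "ereal (- C) \<le> essinf_on M ?B f"
    by (rule le_essinf_onI) (use assms(4) in \<open>auto elim!: eventually_mono\<close>)
  have "e2ennreal (ereal t - essinf_on M ?B f) \<le> ennreal \<bar>t\<bar> + ennreal C" for t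
  proof -
    have "ereal t - essinf_on M ?B f \<le> ereal t - ereal (- C)"
      by (rule ereal_minus_mono[OF order_refl e])
    also have "\<dots> \<le> ereal (\<bar>t\<bar> + C)" by simp
    finally show ?thesis
      using e2ennreal_mono C by (fastforce simp flip: ennreal_plus)
  qed
  then have "(\<integral>\<^sup>+y\<in>?B. e2ennreal (ereal (f y) - essinf_on M ?B f) \<partial>M)
      \<le> (\<integral>\<^sup>+y. ennreal \<bar>f y\<bar> * indicator ?B y + ennreal C * indicator ?B y \<partial>M)"
    by (intro nn_integral_mono) (auto simp: indicator_def)
  also have "\<dots> = (\<integral>\<^sup>+y\<in>?B. ennreal \<bar>f y\<bar> \<partial>M) + ennreal C * emeasure M ?B"
    by (subst nn_integral_add) (auto simp: nn_integral_cmult_indicator)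
  finally have "lower_osc M f x r
      \<le> ((\<integral>\<^sup>+y\<in>?B. ennreal \<bar>f y\<bar> \<partial>M) + ennreal C * emeasure M ?B) / emeasure M ?B"
    unfolding lower_osc_def by (rule divide_right_mono_ennreal)
  also have "\<dots> = abs_mean M f x r + ennreal C"
    using emeasure_ball_pos[OF r, of x] emeasure_ball_finite[OF r, of x]
    unfolding abs_mean_def add_divide_distrib_ennreal by (simp add: mult_divide_eq_ennreal)
  finally show ?thesis .
qed

text \<open>
  Two forms of the triangle inequality, integrated over a ball: one moves the reference constant in
  a mean deviation, the other compares two constants that are both close to \<open>f\<close> in the mean.
\<close>
lemma set_integral_abs_diff_const_le:
  assumes f: "f \<in> L1_loc M" and r: "0 < r"
  shows "(LINT y:ball x r|M. \<bar>f y - c\<bar>)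
    \<le> (LINT y:ball x r|M. \<bar>f y - d\<bar>) + \<bar>c - d\<bar> * measure M (ball x r)"
proof -
  let ?B = "ball x r"
  have int: "set_integrable M ?B (\<lambda>y. \<bar>f y - k\<bar>)" for k
    by (intro set_integrable_abs set_integral_diff(1) L1_locD(2)[OF f r] set_integrable_const_ball r)
  have intc: "set_integrable M ?B (\<lambda>_. \<bar>c - d\<bar>)" by (rule set_integrable_const_ball[OF r])
  have "(LINT y:?B|M. \<bar>f y - c\<bar>) \<le> (LINT y:?B|M. \<bar>f y - d\<bar> + \<bar>c - d\<bar>)"
    by (rule set_integral_mono[OF int set_integral_add(1)[OF int intc]]) auto
  also have "\<dots> = (LINT y:?B|M. \<bar>f y - d\<bar>) + \<bar>c - d\<bar> * measure M ?B"
    using emeasure_ball_finite[OF r, of x]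
    by (subst set_integral_add(2)[OF int intc]) (simp add: set_integral_const less_top mult.commute)
  finally show ?thesis .
qed

lemma abs_diff_const_le:
  assumes f: "f \<in> L1_loc M" and r: "0 < r"
  shows "\<bar>c - d\<bar> * measure M (ball x r)
    \<le> (LINT y:ball x r|M. \<bar>f y - c\<bar>) + (LINT y:ball x r|M. \<bar>f y - d\<bar>)"
proof -
  let ?B = "ball x r"
  have int: "set_integrable M ?B (\<lambda>y. \<bar>f y - k\<bar>)" for k
    by (intro set_integrable_abs set_integral_diff(1) L1_locD(2)[OF f r] set_integrable_const_ball r)
  have intc: "set_integrable M ?B (\<lambda>_. \<bar>c - d\<bar>)" by (rule set_integrable_const_ball[OF r])
  have "\<bar>c - d\<bar> * measure M ?B = (LINT y:?B|M. \<bar>c - d\<bar>)"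
    using emeasure_ball_finite[OF r, of x] by (simp add: set_integral_const less_top mult.commute)
  also have "\<dots> \<le> (LINT y:?B|M. \<bar>f y - c\<bar> + \<bar>f y - d\<bar>)"
    by (rule set_integral_mono[OF intc set_integral_add(1)[OF int int]]) auto
  also have "\<dots> = (LINT y:?B|M. \<bar>f y - c\<bar>) + (LINT y:?B|M. \<bar>f y - d\<bar>)"
    by (rule set_integral_add(2)[OF int int])
  finally show ?thesis .
qed

text \<open>
  The radius \<open>\<rho> x / 2\<close> is small enough for the oscillation bound and, by doubling, large enough for
  the bound on the mean to carry over from radius \<open>\<rho> x\<close>; together they bound the essential infimum.
\<close>
lemma AE_bounded_below_of_small_osc_large_mean:
  assumes f: "f \<in> L1_loc M" and \<rho>: "\<And>x. 0 < \<rho> x" and N: "0 \<le> N"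
    and osc: "\<And>x. lower_osc M f x (\<rho> x / 2) \<le> ennreal N"
    and mean: "\<And>x. abs_mean M f x (\<rho> x) \<le> ennreal N"
  shows "\<exists>C\<ge>0. AE y in M. - C \<le> f y"
proof -
  obtain A where A: "1 \<le> A"
    "\<And>x r. 0 < r \<Longrightarrow> measure M (ball x (2 * r)) \<le> A * measure M (ball x r)"
    using doubling_const[of 2] by blast
  define C where "C = N + N * A"
  have "AE y in M. - C \<le> f y"
  proof (rule AE_if_locally_AE)
    fix z
    let ?r = "\<rho> z / 2"
    have r: "0 < ?r" "0 < \<rho> z" using \<rho> by auto
    obtain m where m: "AE y in M. y \<in> ball z ?r \<longrightarrow> m \<le> f y"
      "(LINT y:ball z ?r|M. \<bar>f y - m\<bar>) \<le> N * measure M (ball z ?r)"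
      using essinf_of_lower_osc[OF f r(1) N osc] by blast
    have "(LINT y:ball z ?r|M. \<bar>f y\<bar>) \<le> (LINT y:ball z (\<rho> z)|M. \<bar>f y\<bar>)"
      using r by (intro set_integral_abs_mono_set L1_locD(2)[OF f]) auto
    also have "\<dots> \<le> N * measure M (ball z (\<rho> z))"
      by (rule set_integral_abs_le[OF f r(2) N mean])
    also have "\<dots> \<le> N * (A * measure M (ball z ?r))"
      using A(2)[OF r(1), of z] N by (intro mult_left_mono) auto
    finally have "\<bar>m\<bar> * measure M (ball z ?r) \<le> C * measure M (ball z ?r)"
      using abs_diff_const_le[OF f r(1), of m 0 z] m(2) by (simp add: C_def algebra_simps)
    then have "\<bar>m\<bar> \<le> C" using measure_ball_pos[OF r(1), of z] by simp
    then have "AE y in M. y \<in> ball z ?r \<longrightarrow> - C \<le> f y"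
      using m(1) by (auto elim!: eventually_mono)
    then show "\<exists>\<delta>>0. AE y in M. y \<in> ball z \<delta> \<longrightarrow> - C \<le> f y" using r by blast
  qed
  moreover have "0 \<le> C" using N A(1) by (simp add: C_def)
  ultimately show ?thesis by blast
qed

end

section \<open>Slow variation of admissible functions\<close>

text \<open>
  Where \<open>dist x y \<le> \<rho> y\<close>, the growth factor in the admissibility condition is at most
  \<open>2 powr k0\<close>, so \<open>\<rho> y \<le> L * \<rho> x\<close>. Shrinking the neighbourhood of \<open>z\<close> to radius \<open>\<rho> z / L\<close> places
  the distance below both \<open>\<rho> z\<close> and \<open>\<rho> x\<close>, so that the comparison applies in both directions.
\<close>
lemma admissible_comparable:
  assumes "admissible \<rho>"
  obtains L where "1 \<le> L"
    and "\<And>x z. dist x z < \<rho> z / L \<Longrightarrow> dist x z < \<rho> x \<and> \<rho> x \<le> L * \<rho> z"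
proof -
  have pos: "\<And>x. 0 < \<rho> x" using assms by (auto simp: admissible_def)
  obtain C0 k0 where C0: "0 < C0" "0 < k0"
    "\<And>x y. 1 / \<rho> x \<le> C0 * (1 / \<rho> y) * (1 + dist x y / \<rho> y) powr k0"
    using assms by (auto simp: admissible_def)
  define L where "L = max 1 (C0 * 2 powr k0)"
  have cmp: "\<rho> y \<le> L * \<rho> x" if "dist x y \<le> \<rho> y" for x y
  proof -
    have "1 + dist x y / \<rho> y \<le> 2" using that pos[of y] by (simp add: divide_le_eq)
    then have "(1 + dist x y / \<rho> y) powr k0 \<le> 2 powr k0"
      using C0(2) pos[of y] by (intro powr_mono2) (auto intro: add_nonneg_nonneg simp: less_imp_le)
    then have "C0 * (1 / \<rho> y) * (1 + dist x y / \<rho> y) powr k0 \<le> C0 * (1 / \<rho> y) * 2 powr k0"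
      using C0(1) pos[of y] by (intro mult_left_mono) (auto simp: less_imp_le)
    also have "\<dots> \<le> L * (1 / \<rho> y)"
      using pos[of y] by (simp add: L_def divide_right_mono)
    finally have "1 / \<rho> x \<le> L * (1 / \<rho> y)" using C0(3)[of x y] by simp
    then show ?thesis using pos[of x] pos[of y] by (simp add: field_simps)
  qed
  show thesis
  proof
    show L1: "1 \<le> L" by (simp add: L_def)
    fix x z assume d: "dist x z < \<rho> z / L"
    have "\<rho> z / L \<le> \<rho> z" using L1 pos[of z] by (simp add: divide_le_eq less_imp_le)
    with d have "\<rho> z \<le> L * \<rho> x" by (intro cmp) simp
    then have "\<rho> z / L \<le> \<rho> x" using L1 by (simp add: divide_le_eq mult.commute)
    with d have "dist x z < \<rho> x" by simp
    then show "dist x z < \<rho> x \<and> \<rho> x \<le> L * \<rho> z" using cmp[of z x] by (simp add: dist_commute)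
  qed
qed

section \<open>Averaging by a kernel localized at scale \<open>\<rho>\<close>\<close>
locale localized_averaging_kernel = doubling_metric_measure M
  for M :: "'a::metric_space measure" +
  fixes \<rho> :: "'a \<Rightarrow> real" and K :: "'a \<Rightarrow> 'a \<Rightarrow> real" and c :: real
  assumes rho_pos: "0 < \<rho> x"
    and K_meas: "(\<lambda>(x, y). K x y) \<in> borel_measurable (M \<Otimes>\<^sub>M M)"
    and K_nonneg: "0 \<le> K x y"
    and c_pos: "0 < c"
    and K_support: "c * min (\<rho> x) (\<rho> y) < dist x y \<Longrightarrow> K x y = 0"
    and K_bound: "K x y \<le> c * (1 / (measure M (ball x (\<rho> x)) + measure M (ball y (\<rho> y))))"
    and K_sym: "K x y = K y x"
    and K_integral: "(\<integral>x. K x y \<partial>M) = 1"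
begin

text \<open>
  The kernel may be nonzero at distance exactly \<open>c * \<rho> x\<close>, so an open ball that carries it needs a
  larger radius. The factor \<open>c + 1\<close> moreover makes the radius at least \<open>\<rho> x\<close>, so that the bound on
  the means over large balls applies to it.
\<close>
abbreviation support_ball :: "'a \<Rightarrow> 'a set" where
  "support_ball x \<equiv> ball x ((c + 1) * \<rho> x)"

lemma support_radius_pos: "0 < (c + 1) * \<rho> x"
  using c_pos rho_pos[of x] by simp

lemma K_measurable [measurable]: "K x \<in> borel_measurable M"
  using measurable_Pair2[OF K_meas, of x] by simp

lemma K_eq_0: "y \<notin> support_ball x \<Longrightarrow> K x y = 0"
proof (rule K_support)
  assume "y \<notin> support_ball x"
  then have "(c + 1) * \<rho> x \<le> dist x y" by (simp add: not_less)
  moreover have "c * min (\<rho> x) (\<rho> y) \<le> c * \<rho> x" using c_pos by (intro mult_left_mono) auto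
  ultimately show "c * min (\<rho> x) (\<rho> y) < dist x y"
    using rho_pos[of x] by (simp add: algebra_simps)
qed

lemma K_le: "K x y \<le> c / measure M (ball x (\<rho> x))"
proof -
  have "c * (1 / (measure M (ball x (\<rho> x)) + measure M (ball y (\<rho> y)))) \<le> c / measure M (ball x (\<rho> x))"
    using c_pos measure_ball_pos[OF rho_pos[of x], of x] by (simp add: frac_le)
  then show ?thesis using K_bound[of x y] by linarith
qed

lemma K_integrable_1: "integrable M (K x)" and K_integral_1: "(\<integral>y. K x y \<partial>M) = 1"
proof -
  have "K x = (\<lambda>y. K y x)" using K_sym by blast
  then show "(\<integral>y. K x y \<partial>M) = 1" using K_integral[of x] by simp
  then show "integrable M (K x)" using not_integrable_integral_eq by fastforce
qed

lemma K_mult_bound: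
  assumes g: "g \<in> borel_measurable M" "set_integrable M (support_ball x) g"
  shows "integrable M (\<lambda>y. K x y * g y)"
    and "\<bar>\<integral>y. K x y * g y \<partial>M\<bar>
      \<le> c / measure M (ball x (\<rho> x)) * (LINT y:support_ball x|M. \<bar>g y\<bar>)"
proof -
  let ?k = "c / measure M (ball x (\<rho> x))" and ?G = "\<lambda>y. indicator (support_ball x) y *\<^sub>R \<bar>g y\<bar>"
  have G: "integrable M (\<lambda>y. ?k * ?G y)"
    using set_integrable_abs[OF g(2)] by (simp add: set_integrable_def)
  have le: "\<bar>K x y * g y\<bar> \<le> ?k * ?G y" for y
    using mult_right_mono[OF K_le[of x y], of "\<bar>g y\<bar>"] K_nonneg[of x y] K_eq_0[of y x]
    by (cases "y \<in> support_ball x") (simp_all add: abs_mult)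
  have "norm (K x y * g y) \<le> norm (?k * ?G y)" for y
    unfolding real_norm_def by (rule order_trans[OF le abs_ge_self])
  then show int: "integrable M (\<lambda>y. K x y * g y)"
    using g(1) by (intro Bochner_Integration.integrable_bound[OF G] AE_I2) auto
  have "\<bar>\<integral>y. K x y * g y \<partial>M\<bar> \<le> (\<integral>y. \<bar>K x y * g y\<bar> \<partial>M)" by (rule integral_abs_bound)
  also have "\<dots> \<le> (\<integral>y. ?k * ?G y \<partial>M)" using int G le by (intro integral_mono) auto
  also have "\<dots> = ?k * (LINT y:support_ball x|M. \<bar>g y\<bar>)"
    by (simp only: set_lebesgue_integral_def integral_mult_right_zero)
  finally show "\<bar>\<integral>y. K x y * g y \<partial>M\<bar> \<le> ?k * (LINT y:support_ball x|M. \<bar>g y\<bar>)" .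
qed

text \<open>
  As the kernel has integral \<open>1\<close>, subtracting \<open>m\<close> from the average of \<open>f\<close> averages \<open>f - m\<close>. The size
  bound on the kernel refers to the ball of radius \<open>\<rho> x\<close>; doubling replaces it by the support ball,
  with a constant independent of \<open>f\<close>, \<open>x\<close> and \<open>m\<close>.
\<close>
lemma kernel_op_bound:
  obtains A where "0 \<le> A"
    and "\<And>f x m N. f \<in> L1_loc M \<Longrightarrow> 0 \<le> N \<Longrightarrow>
      (LINT y:support_ball x|M. \<bar>f y - m\<bar>) \<le> N * measure M (support_ball x) \<Longrightarrow>
      \<bar>kernel_op M K f x - m\<bar> \<le> A * N"
proof -
  obtain A where A: "1 \<le> A"
    "\<And>x r. 0 < r \<Longrightarrow> measure M (ball x ((c + 1) * r)) \<le> A * measure M (ball x r)"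
    using doubling_const[of "c + 1"] by blast
  show thesis
  proof
    show "0 \<le> c * A" using c_pos A(1) by simp
    fix f x m and N :: real
    assume f: "f \<in> L1_loc M" and N: "0 \<le> N"
      and le: "(LINT y:support_ball x|M. \<bar>f y - m\<bar>) \<le> N * measure M (support_ball x)"
    note r = support_radius_pos[of x]
    let ?\<mu> = "measure M (ball x (\<rho> x))"
    have \<mu>: "0 < ?\<mu>" by (rule measure_ball_pos[OF rho_pos])
    have "integrable M (\<lambda>y. K x y * f y)"
      by (rule K_mult_bound(1)[OF L1_locD(1)[OF f] L1_locD(2)[OF f r]])
    then have "kernel_op M K f x - m = (\<integral>y. K x y * (f y - m) \<partial>M)"
      using K_integrable_1[of x] K_integral_1[of x]
      by (simp add: kernel_op_def right_diff_distrib)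
    also have "\<bar>\<dots>\<bar> \<le> c / ?\<mu> * (LINT y:support_ball x|M. \<bar>f y - m\<bar>)"
      using L1_locD(1)[OF f]
      by (intro K_mult_bound(2) set_integral_diff(1) L1_locD(2)[OF f r] set_integrable_const_ball r) auto
    also have "\<dots> \<le> c / ?\<mu> * (N * (A * ?\<mu>))"
      using le A(2)[OF rho_pos[of x], of x] c_pos N
      by (intro mult_left_mono order_trans[OF le]) auto
    also have "\<dots> = c * A * N" using \<mu> by simp
    finally show "\<bar>kernel_op M K f x - m\<bar> \<le> c * A * N" .
  qed
qed

lemma kernel_op_measurable:
  assumes "f \<in> L1_loc M" shows "kernel_op M K f \<in> borel_measurable M"
proof -
  interpret sigma_finite_measure M by (rule sigma_finite)
  note [measurable] = K_meas L1_locD(1)[OF assms]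
  show ?thesis unfolding kernel_op_def by measurable
qed

lemma kernel_op_Linfty:
  assumes f: "f \<in> L1_loc M" and N: "0 \<le> N"
    and mean: "\<And>x r. \<rho> x \<le> r \<Longrightarrow> abs_mean M f x r \<le> ennreal N"
  shows "kernel_op M K f \<in> Linfty M"
proof -
  note [measurable] = kernel_op_measurable[OF f]
  obtain A where A: "\<And>f x m N. f \<in> L1_loc M \<Longrightarrow> 0 \<le> N \<Longrightarrow>
      (LINT y:support_ball x|M. \<bar>f y - m\<bar>) \<le> N * measure M (support_ball x) \<Longrightarrow>
      \<bar>kernel_op M K f x - m\<bar> \<le> A * N"
    using kernel_op_bound by metis
  have "\<bar>kernel_op M K f x\<bar> \<le> A * N" for x
  proof -
    have "\<rho> x \<le> (c + 1) * \<rho> x" using c_pos rho_pos[of x] by simp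
    from set_integral_abs_le[OF f support_radius_pos N mean[OF this]]
    show ?thesis using A[OF f N, of x 0] by simp
  qed
  then have "esssup M (\<lambda>x. ereal \<bar>kernel_op M K f x\<bar>) \<le> ereal (A * N)"
    by (intro esssup_I) auto
  also have "\<dots> < \<infinity>" by simp
  finally show ?thesis by (simp add: Linfty_def kernel_op_measurable[OF f])
qed

text \<open>
  The kernel estimate controls the essential infimum over the support ball of almost every point.
  Such points are dense, and the slow variation of \<open>\<rho>\<close> makes the support balls of those near \<open>z\<close>
  comparable with the ball of radius \<open>\<rho> z\<close> about \<open>z\<close>.
\<close>
lemma abs_mean_bounded_of_BLO:
  assumes adm: "admissible \<rho>" and f: "f \<in> L1_loc M" and N: "0 \<le> N"
    and osc: "\<And>x r. 0 < r \<Longrightarrow> lower_osc M f x r \<le> ennreal N"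
    and Kf: "kernel_op M K f \<in> Linfty M"
  shows "\<exists>C\<ge>0. \<forall>x r. \<rho> x \<le> r \<longrightarrow> abs_mean M f x r \<le> ennreal C"
proof -
  obtain A where A: "0 \<le> A" "\<And>f x m N. f \<in> L1_loc M \<Longrightarrow> 0 \<le> N \<Longrightarrow>
      (LINT y:support_ball x|M. \<bar>f y - m\<bar>) \<le> N * measure M (support_ball x) \<Longrightarrow>
      \<bar>kernel_op M K f x - m\<bar> \<le> A * N"
    using kernel_op_bound by metis
  obtain L where L: "1 \<le> L"
    "\<And>x z. dist x z < \<rho> z / L \<Longrightarrow> dist x z < \<rho> x \<and> \<rho> x \<le> L * \<rho> z"
    using admissible_comparable[OF adm] by blast
  obtain E :: real where E: "0 \<le> E" "AE x in M. \<bar>kernel_op M K f x\<bar> \<le> E"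
  proof -
    have "esssup M (\<lambda>x. ereal \<bar>kernel_op M K f x\<bar>) < \<infinity>" using Kf by (simp add: Linfty_def)
    then obtain e :: nat where "esssup M (\<lambda>x. ereal \<bar>kernel_op M K f x\<bar>) < ereal (real e)"
      using less_PInf_Ex_of_nat by auto
    then have "AE x in M. \<bar>kernel_op M K f x\<bar> \<le> real e"
      using esssup_AE[of "\<lambda>x. ereal \<bar>kernel_op M K f x\<bar>" M]
      by (auto elim!: eventually_mono dest!: order.strict_trans1)
    then show thesis using that[of "real e"] by simp
  qed
  define D where "D = E + A * N"
  have D: "0 \<le> D" using E(1) A(1) N by (simp add: D_def)
  have near: "\<exists>x m. dist x z < \<rho> z / L \<and> \<bar>m\<bar> \<le> D \<and>
      essinf_on M (support_ball x) f = ereal m \<and>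
      (AE y in M. y \<in> support_ball x \<longrightarrow> m \<le> f y)" for z
  proof -
    have "0 < \<rho> z / L" using rho_pos[of z] L(1) by simp
    then obtain x where x: "x \<in> ball z (\<rho> z / L)" "\<bar>kernel_op M K f x\<bar> \<le> E"
      using AE_obtain_in_ball[OF E(2)] by blast
    obtain m where m: "essinf_on M (support_ball x) f = ereal m"
      "AE y in M. y \<in> support_ball x \<longrightarrow> m \<le> f y"
      "(LINT y:support_ball x|M. \<bar>f y - m\<bar>) \<le> N * measure M (support_ball x)"
      using essinf_of_lower_osc[OF f support_radius_pos N osc[OF support_radius_pos]] by blast
    have "\<bar>m\<bar> \<le> D" using A(2)[OF f N m(3)] x(2) by (simp add: D_def)
    then show ?thesis using x(1) m by (auto simp: dist_commute)
  qed
  have below: "AE y in M. - D \<le> f y"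
  proof (rule AE_if_locally_AE)
    fix z
    obtain x m where x: "dist x z < \<rho> z / L" "\<bar>m\<bar> \<le> D"
      "AE y in M. y \<in> support_ball x \<longrightarrow> m \<le> f y" using near by blast
    have "dist x z < \<rho> x" using L(2)[OF x(1)] by simp
    also have "\<dots> \<le> (c + 1) * \<rho> x" using c_pos rho_pos[of x] by simp
    finally have "z \<in> support_ball x" by simp
    then obtain \<delta> where \<delta>: "0 < \<delta>" "ball z \<delta> \<subseteq> support_ball x"
      by (rule openE[OF open_ball])
    have "AE y in M. y \<in> ball z \<delta> \<longrightarrow> - D \<le> f y"
      using x(2,3) \<delta>(2) by (auto elim!: eventually_mono)
    then show "\<exists>\<delta>>0. AE y in M. y \<in> ball z \<delta> \<longrightarrow> - D \<le> f y" using \<delta>(1) by blast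
  qed
  \<comment> \<open>The support ball of \<open>x\<close> has radius at most \<open>(c + 1) * L * \<rho> z\<close>; the distance of \<open>x\<close> from \<open>z\<close>
    costs at most another \<open>L * \<rho> z\<close>.\<close>
  define R where "R = (c + 2) * L"
  have R: "1 \<le> R"
    using mult_mono[of 1 "c + 2" 1 L] L(1) c_pos by (simp add: R_def)
  obtain A' where A': "1 \<le> A'"
    "\<And>x r. 0 < r \<Longrightarrow> measure M (ball x (R * r)) \<le> A' * measure M (ball x r)"
    using doubling_const[of R] by blast
  define C where "C = (N + D) * A'"
  have "abs_mean M f z r \<le> ennreal C" if "\<rho> z \<le> r" for z r
  proof -
    have r: "0 < r" using that rho_pos[of z] by linarith
    have Rr: "0 < R * r" using r R by simp
    obtain x m where x: "dist x z < \<rho> z / L" "\<bar>m\<bar> \<le> D"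
      "essinf_on M (support_ball x) f = ereal m" using near by blast
    have "support_ball x \<subseteq> ball z (R * r)"
    proof
      fix y assume "y \<in> support_ball x"
      then have "dist z y < \<rho> x + (c + 1) * \<rho> x"
        using L(2)[OF x(1)] dist_triangle[of z y x] by (simp add: dist_commute)
      also have "\<dots> = (c + 2) * \<rho> x" by (simp add: algebra_simps)
      also have "\<dots> \<le> (c + 2) * (L * r)"
      proof (rule mult_left_mono)
        have "L * \<rho> z \<le> L * r" using that L(1) by (intro mult_left_mono) auto
        then show "\<rho> x \<le> L * r" using L(2)[OF x(1)] by linarith
      qed (use c_pos in simp)
      finally show "y \<in> ball z (R * r)" by (simp add: R_def mult.assoc)
    qed
    \<comment> \<open>Enlarging the ball lowers the infimum, so the bound on the support ball of a single point
      gives the upper bound; the lower one comes from the global bound on \<open>f\<close>.\<close>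
    then have upper: "essinf_on M (ball z (R * r)) f \<le> ereal m"
      using essinf_on_antimono x(3) by metis
    obtain m' where m': "essinf_on M (ball z (R * r)) f = ereal m'"
      "(LINT y:ball z (R * r)|M. \<bar>f y - m'\<bar>) \<le> N * measure M (ball z (R * r))"
      using essinf_of_lower_osc[OF f Rr N osc[OF Rr]] by blast
    have "ereal (- D) \<le> essinf_on M (ball z (R * r)) f"
      by (rule le_essinf_onI) (use below in \<open>auto elim!: eventually_mono\<close>)
    then have "\<bar>m'\<bar> \<le> D" using upper x(2) by (simp add: m'(1))
    have "(LINT y:ball z r|M. \<bar>f y\<bar>) \<le> (LINT y:ball z (R * r)|M. \<bar>f y\<bar>)"
      using R r by (intro set_integral_abs_mono_set L1_locD(2)[OF f Rr] subset_ball) auto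
    also have "\<dots> \<le> N * measure M (ball z (R * r)) + \<bar>m'\<bar> * measure M (ball z (R * r))"
      using set_integral_abs_diff_const_le[OF f Rr, of z 0 m'] m'(2) by simp
    also have "\<dots> \<le> (N + D) * measure M (ball z (R * r))"
      using mult_right_mono[OF \<open>\<bar>m'\<bar> \<le> D\<close>, of "measure M (ball z (R * r))"]
      by (simp add: distrib_right)
    also have "\<dots> \<le> (N + D) * (A' * measure M (ball z r))"
      using A'(2)[OF r] N D by (intro mult_left_mono) auto
    finally have "(LINT y:ball z r|M. \<bar>f y\<bar>) / measure M (ball z r) \<le> C"
      unfolding C_def pos_divide_le_eq[OF measure_ball_pos[OF r]] mult.assoc .
    then show ?thesis unfolding abs_mean_eq[OF f r] by (rule ennreal_leI)
  qed
  moreover have "0 \<le> C" using N D A'(1) by (simp add: C_def)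
  ultimately show ?thesis by blast
qed

end

section \<open>The spaces in terms of uniform bounds\<close>
lemma ennreal_finite_iff_le_real: "(a::ennreal) < \<infinity> \<longleftrightarrow> (\<exists>N\<ge>0. a \<le> ennreal N)"
proof
  assume "a < \<infinity>"
  then have "a \<le> ennreal (enn2real a)" by (simp add: ennreal_enn2real)
  then show "\<exists>N\<ge>0. a \<le> ennreal N" using enn2real_nonneg by blast
next
  assume "\<exists>N\<ge>0. a \<le> ennreal N"
  then show "a < \<infinity>" using le_less_trans[OF _ ennreal_less_top] by auto
qed

lemma BLO_iff:
  "f \<in> BLO M \<longleftrightarrow> f \<in> L1_loc M \<and> (\<exists>N\<ge>0. \<forall>x r. 0 < r \<longrightarrow> lower_osc M f x r \<le> ennreal N)"
proof -
  have "BLO_norm M f < \<infinity> \<longleftrightarrow> (\<exists>N\<ge>0. BLO_norm M f \<le> ennreal N)"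
    by (rule ennreal_finite_iff_le_real)
  also have "\<dots> \<longleftrightarrow> (\<exists>N\<ge>0. \<forall>x r. 0 < r \<longrightarrow> lower_osc M f x r \<le> ennreal N)"
    by (auto simp: BLO_norm_def all_balls_def SUP_le_iff)
  finally show ?thesis by (auto simp: BLO_def)
qed

lemma BLO_rho_iff:
  assumes "\<And>x. 0 < \<rho> x"
  shows "f \<in> BLO_rho M \<rho> \<longleftrightarrow> f \<in> L1_loc M \<and>
    (\<exists>N\<ge>0. (\<forall>x r. 0 < r \<and> r < \<rho> x \<longrightarrow> lower_osc M f x r \<le> ennreal N) \<and>
      (\<forall>x r. \<rho> x \<le> r \<longrightarrow> abs_mean M f x r \<le> ennreal N))"
proof -
  let ?S = "SUP (x, r)\<in>all_balls - large_balls \<rho>. lower_osc M f x r"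
  let ?T = "SUP (x, r)\<in>large_balls \<rho>. abs_mean M f x r"
  have norm: "BLO_rho_norm M \<rho> f < \<infinity> \<longleftrightarrow> (\<exists>N\<ge>0. ?S \<le> ennreal N \<and> ?T \<le> ennreal N)"
  proof
    assume "BLO_rho_norm M \<rho> f < \<infinity>"
    then obtain N where N: "0 \<le> N" "?S + ?T \<le> ennreal N"
      unfolding BLO_rho_norm_def ennreal_finite_iff_le_real by blast
    have "?S \<le> ?S + ?T" "?T \<le> ?S + ?T" by (rule add_increasing2 add_increasing; simp)+
    with N(2) have "?S \<le> ennreal N" "?T \<le> ennreal N" by (blast intro: order_trans)+
    with N(1) show "\<exists>N\<ge>0. ?S \<le> ennreal N \<and> ?T \<le> ennreal N" by blast
  next
    assume "\<exists>N\<ge>0. ?S \<le> ennreal N \<and> ?T \<le> ennreal N"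
    then obtain N where "?S \<le> ennreal N" "?T \<le> ennreal N" by blast
    then have "?S + ?T \<le> ennreal N + ennreal N" by (rule add_mono)
    also have "\<dots> < \<infinity>" by simp
    finally show "BLO_rho_norm M \<rho> f < \<infinity>" unfolding BLO_rho_norm_def .
  qed
  have S: "?S \<le> ennreal N \<longleftrightarrow> (\<forall>x r. 0 < r \<and> r < \<rho> x \<longrightarrow> lower_osc M f x r \<le> ennreal N)" for N
    unfolding SUP_le_iff by (force simp: all_balls_def large_balls_def)
  have T: "?T \<le> ennreal N \<longleftrightarrow> (\<forall>x r. \<rho> x \<le> r \<longrightarrow> abs_mean M f x r \<le> ennreal N)" for N
    using less_le_trans[OF assms] by (auto simp: all_balls_def large_balls_def SUP_le_iff)
  show ?thesis unfolding BLO_rho_def mem_Collect_eq norm S T by simp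
qed

section \<open>The characterization\<close>
theorem corollary3p3:
  fixes M :: "'a::metric_space measure"
    and \<rho> :: "'a \<Rightarrow> real"
    and K :: "'a \<Rightarrow> 'a \<Rightarrow> real"
    and C5 :: real
  assumes "RD_space M"
    and "admissible \<rho>"
    and K_meas: "(\<lambda>(x, y). K x y) \<in> borel_measurable (M \<Otimes>\<^sub>M M)"
    and K_nonneg: "\<And>x y. 0 \<le> K x y"
    and C5_pos: "0 < C5"
    and K1: "\<And>x y. dist x y > C5 * min (\<rho> x) (\<rho> y) \<Longrightarrow> K x y = 0"
    and K2: "\<And>x y. K x y \<le> C5 * (1 / (measure M (ball x (\<rho> x)) + measure M (ball y (\<rho> y))))"
    and K3: "\<And>x y. K x y = K y x"
    and K4: "\<And>y. (\<integral>x. K x y \<partial>M) = 1"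
  shows "BLO_rho M \<rho> = {f \<in> BLO M. kernel_op M K f \<in> Linfty M}"
proof -
  have \<rho>: "\<And>x. 0 < \<rho> x" using assms(2) by (simp add: admissible_def)
  interpret doubling_metric_measure M
    by unfold_locales (use assms(1) in \<open>auto simp: RD_space_def regular_borel_measure_def\<close>)
  interpret localized_averaging_kernel M \<rho> K C5
    by unfold_locales (fact \<rho> K_meas K_nonneg C5_pos K1 K2 K3 K4)+
  show ?thesis
  proof (intro set_eqI iffI)
    fix f assume "f \<in> BLO_rho M \<rho>"
    then obtain N where f: "f \<in> L1_loc M" and N: "0 \<le> N"
      and osc: "\<And>x r. 0 < r \<Longrightarrow> r < \<rho> x \<Longrightarrow> lower_osc M f x r \<le> ennreal N"
      and mean: "\<And>x r. \<rho> x \<le> r \<Longrightarrow> abs_mean M f x r \<le> ennreal N"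
      unfolding BLO_rho_iff[OF \<rho>] by blast
    have "lower_osc M f x (\<rho> x / 2) \<le> ennreal N" for x using \<rho>[of x] by (intro osc) auto
    then obtain C where C: "0 \<le> C" "AE y in M. - C \<le> f y"
      using AE_bounded_below_of_small_osc_large_mean[OF f \<rho> N _ mean[OF order_refl]] by blast
    have "lower_osc M f x r \<le> ennreal (N + C)" if r: "0 < r" for x r
    proof (cases "r < \<rho> x")
      case True
      have "ennreal N \<le> ennreal (N + C)" using C(1) by (intro ennreal_leI) simp
      then show ?thesis by (rule order_trans[OF osc[OF r True]])
    next
      case False
      have "lower_osc M f x r \<le> abs_mean M f x r + ennreal C" by (rule lower_osc_le[OF f r C])
      also have "\<dots> \<le> ennreal N + ennreal C" using mean[of x r] False by (intro add_right_mono) simp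
      finally show ?thesis using N C(1) by simp
    qed
    moreover have "0 \<le> N + C" using N C(1) by simp
    ultimately have "f \<in> BLO M" unfolding BLO_iff using f by blast
    then show "f \<in> {f \<in> BLO M. kernel_op M K f \<in> Linfty M}"
      using kernel_op_Linfty[OF f N mean] by simp
  next
    fix f assume "f \<in> {f \<in> BLO M. kernel_op M K f \<in> Linfty M}"
    then obtain N where f: "f \<in> L1_loc M" and N: "0 \<le> N"
      and osc: "\<And>x r. 0 < r \<Longrightarrow> lower_osc M f x r \<le> ennreal N"
      and Kf: "kernel_op M K f \<in> Linfty M"
      by (auto simp: BLO_iff)
    obtain C where C: "0 \<le> C" "\<And>x r. \<rho> x \<le> r \<Longrightarrow> abs_mean M f x r \<le> ennreal C"
      using abs_mean_bounded_of_BLO[OF assms(2) f N osc Kf] by blast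
    have "lower_osc M f x r \<le> ennreal (max N C)" if "0 < r" for x r
      using osc[OF that] by (rule order_trans) (simp add: ennreal_leI)
    moreover have "abs_mean M f x r \<le> ennreal (max N C)" if "\<rho> x \<le> r" for x r
      using C(2)[OF that] by (rule order_trans) (simp add: ennreal_leI)
    moreover have "0 \<le> max N C" using N by simp
    ultimately show "f \<in> BLO_rho M \<rho>"
      unfolding BLO_rho_iff[OF \<rho>] using f by blast
  qed
qed

end
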